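(* Let $k$ be a positive integer, let $G$ be an $n$-vertex graph, and let $(M,x)\in\mathcal{M}_k(G)$. Then the following statements hold: (1) For any $k$-independent set $S$ of $G$, $$|S|^2\leq x^\top M^\#x\sum_{u\in S}\frac{(M)_{uu}}{x_u^2}.$$ (2) The $k$-independence number $\alpha_k(G)$ satisfies $$\alpha_k(G)\leq x^\top M^\#x\max_{u\in V(G)}\frac{(M)_{uu}}{x_u^2}.$$ (3) For any $k$-distance coloring $V(G)=V_1\cup\cdots\cup V_t$ of $G$, $$\sum_{i=1}^t|V_i|^2\leq x^\top M^\#x\sum_{u\in V(G)}\frac{(M)_{uu}}{x_u^2}.$$
   Context: Graphs are finite, simple, undirected, with nonempty vertex set $V(G)$. $d(i,j)$ denotes the distance between vertices $i$ and $j$ in $G$ (with $d(i,j)=\infty$ if they lie in different components). A $k$-independent set of $G$ is a subset $U\subseteq V(G)$ with $d(i,j)>k$ for any two distinct $i,j\in U$; $\alpha_k(G)$ is the maximum size of a $k$-independent set. A $k$-distance coloring of $G$ is a partition $V(G)=V_1\cup\cdots\cup V_t$ in which every $V_i$ is a $k$-independent set. For an $n$-vertex graph $G$, $\mathcal{M}_k(G)$ is the set of pairs $(M,x)$ such that: (a) $M$ is a (symmetric) positive semidefinite real $n\times n$ matrix indexed by the vertices of $G$ with $(M)_{ij}=0$ whenever $d(i,j)>k$; (b) $x=(x_1,\ldots,x_n)^\top\in\mathbb{R}^n$ lies in the range $R(M)=\{My: y\in\mathbb{R}^n\}$ and $x_i\neq 0$ for all $i$. The group inverse $M^\#$ of a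 real square matrix $M$ is the matrix $X$ (unique if it exists) with $MXM=M$, $XMX=X$, $MX=XM$. It exists for positive semidefinite $M$: if $M=U\,\mathrm{diag}(\lambda_1,\ldots,\lambda_n)U^\top$ with $U$ orthogonal, then $M^\#=U\,\mathrm{diag}(\lambda_1^+,\ldots,\lambda_n^+)U^\top$, where $\lambda_i^+=\lambda_i^{-1}$ if $\lambda_i>0$ and $\lambda_i^+=0$ if $\lambda_i=0$. *)

theory Defs
  imports "HOL-Analysis.Analysis" "Graph_Theory.Graph_Theory"
begin

text \<open>
  Finite simple undirected graphs are \<^locale>\<open>pair_graph\<close>s, that is, each edge is stored
  as two opposite arcs. Matrices and vectors are indexed by the vertex type
  \<open>'n :: finite\<close>, so the graphs considered have \<open>pverts G = UNIV\<close>; an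
  \<open>n\<close>-vertex graph is one with \<open>CARD('n) = n\<close>.
\<close>

text \<open>
  With unit arc weights \<open>\<mu>\<close> is the infimum of the lengths of the walks from \<open>u\<close> to \<open>v\<close>,
  which is \<open>\<infinity>\<close> if there is no such walk.
\<close>

definition graph_dist :: "'a pair_pre_digraph \<Rightarrow> 'a \<Rightarrow> 'a \<Rightarrow> ereal" where
  "graph_dist G u v = wf_digraph.\<mu> (with_proj G) (\<lambda>_. 1) u v"

definition k_independent :: "nat \<Rightarrow> 'a pair_pre_digraph \<Rightarrow> 'a set \<Rightarrow> bool" where
  "k_independent k G U \<longleftrightarrow>
     U \<subseteq> pverts G \<and> (\<forall>i\<in>U. \<forall>j\<in>U. i \<noteq> j \<longrightarrow> graph_dist G i j > ereal (real k))"

definition k_independence_number :: "nat \<Rightarrow> 'a pair_pre_digraph \<Rightarrow> nat" where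
  "k_independence_number k G = Max {card U | U. k_independent k G U}"

text \<open>
  The classes are \<open>V 1, \<dots>, V t\<close>; a class may be empty.
\<close>

definition k_distance_coloring ::
    "nat \<Rightarrow> 'a pair_pre_digraph \<Rightarrow> nat \<Rightarrow> (nat \<Rightarrow> 'a set) \<Rightarrow> bool" where
  "k_distance_coloring k G t V \<longleftrightarrow>
     (\<Union>i\<in>{1..t}. V i) = pverts G \<and> disjoint_family_on V {1..t} \<and>
     (\<forall>i\<in>{1..t}. k_independent k G (V i))"

definition pos_semidef :: "real^'n^'n \<Rightarrow> bool" where
  "pos_semidef M \<longleftrightarrow> transpose M = M \<and> (\<forall>y. y \<bullet> (M *v y) \<ge> 0)"

definition matrix_vector_pairs ::
    "nat \<Rightarrow> 'n::finite pair_pre_digraph \<Rightarrow> ((real^'n^'n) \<times> (real^'n)) set" where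
  "matrix_vector_pairs k G =
     {(M, x). pos_semidef M \<and>
              (\<forall>i j. graph_dist G i j > ereal (real k) \<longrightarrow> M $ i $ j = 0) \<and>
              x \<in> range (\<lambda>y. M *v y) \<and> (\<forall>i. x $ i \<noteq> 0)}"

definition is_group_inverse :: "real^'n^'n \<Rightarrow> real^'n^'n \<Rightarrow> bool" where
  "is_group_inverse M X \<longleftrightarrow> M ** X ** M = M \<and> X ** M ** X = X \<and> M ** X = X ** M"

definition group_inverse :: "real^'n^'n \<Rightarrow> real^'n^'n" where
  "group_inverse M = (THE X. is_group_inverse M X)"

lemma is_group_inverse_unique:
  assumes "is_group_inverse M X" "is_group_inverse M Y"
  shows "X = Y"
proof -
  have X: "M ** X ** M = M" "X ** M ** X = X" "M ** X = X ** M"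
    and Y: "M ** Y ** M = M" "Y ** M ** Y = Y" "M ** Y = Y ** M"
    using assms unfolding is_group_inverse_def by blast+
  have "X ** M = M ** Y ** M ** X"
    using X(3) Y(1) by simp
  also have "\<dots> = (M ** Y) ** (M ** X)"
    by (simp only: matrix_mul_assoc)
  also have "\<dots> = (Y ** M) ** (X ** M)"
    by (simp only: Y(3) X(3))
  also have "\<dots> = Y ** (M ** X ** M)"
    by (simp only: matrix_mul_assoc)
  finally have XM: "X ** M = Y ** M"
    by (simp only: X(1))
  have "X = Y ** M ** X"
    using X(2) XM by simp
  also have "\<dots> = Y ** (Y ** M)"
    by (simp only: matrix_mul_assoc[symmetric] X(3) XM)
  also have "\<dots> = Y ** M ** Y"
    by (simp only: matrix_mul_assoc[symmetric] Y(3))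
  finally show ?thesis
    using Y(2) by simp
qed

lemma symmetric_has_group_inverse:
  fixes M :: "real^'n^'n"
  assumes sym: "transpose M = M"
  shows "\<exists>X. is_group_inverse M X"
proof -
  let ?S = "range ((*v) M)"
  have sub: "subspace ?S"
    by (simp add: linear_subspace_image)
  have ker: "w = 0" if "w \<in> ?S" "M *v w = 0" for w
  proof -
    from that obtain y where y: "w = M *v y" by auto
    have "w \<bullet> w = (M *v w) \<bullet> y"
      using dot_lmul_matrix[of w M y] transpose_matrix_vector[of M w] sym y by simp
    with that show ?thesis by simp
  qed
  have "inj_on ((*v) M) ?S"
  proof (rule inj_onI)
    fix a b assume ab: "a \<in> ?S" "b \<in> ?S" "M *v a = M *v b"
    then have "a - b \<in> ?S" using sub by (simp add: subspace_diff)
    moreover have "M *v (a - b) = 0"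
      using ab by (simp add: matrix_vector_mult_diff_distrib)
    ultimately have "a - b = 0" by (rule ker)
    then show "a = b" by simp
  qed
  moreover have "span ?S = ?S" using sub by (rule span_eq_iff[THEN iffD2])
  ultimately have "inj_on ((*v) M) (span ?S)" by (simp only:)
  then have "dim ((*v) M ` ?S) = dim ?S"
    by (intro dim_image_eq) auto
  then have surj: "(*v) M ` ?S = ?S"
    by (intro subspace_dim_equal) (auto simp: sub linear_subspace_image)
  have "\<exists>b. M *v (M *v b) = column j M" for j
  proof -
    have "column j M \<in> ?S"
      by (simp flip: matrix_vector_mult_basis)
    then have "column j M \<in> (*v) M ` ?S" by (simp only: surj)
    then show ?thesis by auto
  qed
  then obtain b where b: "\<And>j. M *v (M *v b j) = column j M" by metis
  define B where "B = (\<chi> i j. b j $ i)"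
  have "column j (M ** (M ** B)) = column j M" for j
    using b[of j]
    by (simp add: B_def vec_eq_iff column_def matrix_matrix_mult_def matrix_vector_mult_def)
  then have MB: "M ** (M ** B) = M"
    by (simp add: vec_eq_iff column_def)
  define C where "C = transpose B"
  have CM: "C ** M ** M = M"
    using arg_cong[OF MB, of transpose] by (simp add: matrix_transpose_mul sym C_def)
  have "C ** M = C ** (M ** (M ** B))"
    by (simp only: MB)
  also have "\<dots> = C ** M ** M ** B"
    by (simp only: matrix_mul_assoc)
  finally have eq: "C ** M = M ** B"
    by (simp only: CM)
  define X where "X = C ** M ** B"
  have "M ** X = M ** (M ** B) ** B"
    by (simp only: X_def eq matrix_mul_assoc)
  then have MX: "M ** X = M ** B"
    by (simp only: MB)
  have "X ** M = C ** (M ** B) ** M"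
    by (simp only: X_def matrix_mul_assoc)
  also have "\<dots> = C ** (C ** M ** M)"
    by (simp only: eq[symmetric] matrix_mul_assoc)
  finally have "X ** M = C ** M"
    by (simp only: CM)
  then have XM: "X ** M = M ** B"
    by (simp only: eq)
  have "M ** X ** M = M"
    by (simp only: MX eq[symmetric] CM)
  moreover have "X ** M ** X = X"
  proof -
    have "X ** M ** X = C ** M ** X"
      by (simp only: XM eq)
    also have "\<dots> = C ** (M ** B)"
      by (simp only: MX matrix_mul_assoc[symmetric])
    finally show ?thesis
      by (simp only: X_def matrix_mul_assoc)
  qed
  ultimately have "is_group_inverse M X"
    by (simp add: is_group_inverse_def MX XM)
  then show ?thesis ..
qed

lemma group_inverse_symmetric:
  assumes "transpose M = M"
  shows "is_group_inverse M (group_inverse M)"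
  unfolding group_inverse_def
  by (rule theI') (use symmetric_has_group_inverse[OF assms] is_group_inverse_unique in blast)

end

theory Submission
  imports Defs
begin

text \<open>
  As \<open>x\<close> lies in the range of \<open>M\<close>, the vector \<open>z = M\<^sup># x\<close> satisfies \<open>M z = x\<close>.
  Given a \<open>k\<close>-independent set \<open>S\<close>, let \<open>w\<close> have the entries \<open>1 / x\<^sub>u\<close> on \<open>S\<close> and \<open>0\<close>
  elsewhere. Then \<open>w \<bullet> M z = w \<bullet> x = |S|\<close>, whereas \<open>M\<close> is diagonal on \<open>S\<close>, so that
  \<open>w \<bullet> M w\<close> is the sum of \<open>M\<^sub>u\<^sub>u / x\<^sub>u\<^sup>2\<close> over \<open>S\<close>. Part (1) is the Cauchy-Schwarz inequality
  for the semi-inner product defined by \<open>M\<close>; parts (2) and (3) follow by applying it to a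
  largest \<open>k\<close>-independent set and to every colour class.
\<close>

text \<open>The form of \<open>M\<close> is nonnegative at every combination of \<open>w\<close> and
  \<open>z\<close>; suitable coefficients give the inequality. Since the form may be degenerate,
  \<open>c = 0\<close> is treated separately.\<close>

lemma pos_semidef_Cauchy_Schwarz:
  fixes M :: "real^'n^'n"
  assumes "pos_semidef M"
  shows "(w \<bullet> (M *v z))\<^sup>2 \<le> (w \<bullet> (M *v w)) * (z \<bullet> (M *v z))"
proof -
  define a b c where "a = w \<bullet> (M *v w)" and "b = w \<bullet> (M *v z)" and "c = z \<bullet> (M *v z)"
  have nonneg: "y \<bullet> (M *v y) \<ge> 0" for y
    using assms by (simp add: pos_semidef_def)
  have sym: "z \<bullet> (M *v w) = b"
    using assms dot_lmul_matrix[of z M w] transpose_matrix_vector[of M z]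
    by (simp add: pos_semidef_def b_def inner_commute)
  have quad: "s\<^sup>2 * a - 2 * s * t * b + t\<^sup>2 * c \<ge> 0" for s t
    using nonneg[of "s *\<^sub>R w - t *\<^sub>R z"]
    by (simp add: matrix_vector_mult_diff_distrib matrix_vector_mult_scaleR inner_diff_left
        inner_diff_right sym flip: a_def b_def c_def)
      (simp add: power2_eq_square algebra_simps)
  have "c \<ge> 0" unfolding c_def by (rule nonneg)
  have "b\<^sup>2 \<le> a * c"
  proof (cases "c = 0")
    case True
    have "b = 0"
    proof (rule ccontr)
      assume "b \<noteq> 0"
      \<comment> \<open>For \<open>c = 0\<close> the form is affine in \<open>t\<close> when
        \<open>s = 1\<close>; this \<open>t\<close> makes it
        \<open>a - (a + 1) = -1\<close>.\<close>
      with quad[of 1 "(a + 1) / (2 * b)"] True show False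
        using nonneg[of w] by (simp add: a_def field_simps)
    qed
    with True show ?thesis by simp
  next
    case False
    with \<open>c \<ge> 0\<close> have "c > 0" by simp
    \<comment> \<open>The coefficients \<open>s = c\<close>, \<open>t = b\<close> minimise the form
      up to scaling.\<close>
    have "c * (a * c - b\<^sup>2) \<ge> 0"
      using quad[of c b] by (simp add: power2_eq_square algebra_simps)
    with \<open>c > 0\<close> show ?thesis by (simp add: zero_le_mult_iff)
  qed
  then show ?thesis by (simp add: a_def b_def c_def)
qed

lemma pos_semidef_diagonal_nonneg:
  fixes M :: "real^'n^'n"
  assumes "pos_semidef M"
  shows "M $ u $ u \<ge> 0"
proof -
  have "axis u 1 \<bullet> (M *v axis u 1) \<ge> 0"
    using assms by (simp add: pos_semidef_def)
  then show ?thesis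
    by (simp add: matrix_vector_mult_basis column_def inner_axis')
qed

lemma range_group_inverse:
  fixes M :: "real^'n^'n"
  assumes "transpose M = M" and "x \<in> range ((*v) M)"
  shows "M *v (group_inverse M *v x) = x"
proof -
  obtain y where y: "x = M *v y"
    using assms(2) by blast
  have "M ** group_inverse M ** M = M"
    using group_inverse_symmetric[OF assms(1)] unfolding is_group_inverse_def by blast
  then show ?thesis
    by (simp add: y matrix_vector_mul_assoc matrix_mul_assoc)
qed

text \<open>With \<open>z = M\<^sup># x\<close> and \<open>M z = x\<close>, this number is the value
  of the form of \<open>M\<close> at \<open>z\<close>.\<close>

lemma group_inverse_form_nonneg:
  fixes M :: "real^'n^'n"
  assumes "pos_semidef M" and "x \<in> range ((*v) M)"
  shows "x \<bullet> (group_inverse M *v x) \<ge> 0"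
proof -
  let ?z = "group_inverse M *v x"
  have "?z \<bullet> (M *v ?z) \<ge> 0"
    using assms(1) by (simp add: pos_semidef_def)
  then show ?thesis
    using assms range_group_inverse[of M x] by (simp add: pos_semidef_def inner_commute)
qed

text \<open>This is part (1) freed from the graph: independence enters only as the vanishing of the
  off-diagonal entries of \<open>M\<close> on \<open>S\<close>.\<close>

lemma card_squared_le_of_diagonal_on:
  fixes M :: "real^'n^'n"
  assumes psd: "pos_semidef M" and x: "x \<in> range ((*v) M)" "\<And>i. i \<in> S \<Longrightarrow> x $ i \<noteq> 0"
    and diag: "\<And>i j. i \<in> S \<Longrightarrow> j \<in> S \<Longrightarrow> i \<noteq> j \<Longrightarrow> M $ i $ j = 0"
  shows "(real (card S))\<^sup>2
    \<le> (x \<bullet> (group_inverse M *v x)) * (\<Sum>u\<in>S. M $ u $ u / (x $ u)\<^sup>2)"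
proof -
  define z where "z = group_inverse M *v x"
  define w :: "real^'n" where "w = (\<chi> i. if i \<in> S then 1 / x $ i else 0)"
  have Mz: "M *v z = x"
    using psd x(1) by (simp add: z_def range_group_inverse pos_semidef_def)
  have w_inner: "w \<bullet> v = (\<Sum>i\<in>S. v $ i / x $ i)" for v
    by (simp add: inner_vec_def w_def if_distrib[of "\<lambda>a. a * _"] sum.If_cases cong: if_cong)
  have "(M *v w) $ i = M $ i $ i / x $ i" if "i \<in> S" for i
  proof -
    have "(M *v w) $ i = (\<Sum>j\<in>UNIV. M $ i $ j * w $ j)"
      by (simp add: matrix_vector_mult_def)
    \<comment> \<open>For \<open>j \<noteq> i\<close>, either \<open>j\<close> is outside
      \<open>S\<close> and \<open>w\<close> vanishes there, or \<open>M $ i $ j = 0\<close>.\<close>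
    also have "\<dots> = (\<Sum>j\<in>UNIV. if j = i then M $ i $ i / x $ i else 0)"
      using that diag by (intro sum.cong) (auto simp: w_def)
    finally show ?thesis by simp
  qed
  then have "w \<bullet> (M *v w) = (\<Sum>u\<in>S. M $ u $ u / (x $ u)\<^sup>2)"
    unfolding w_inner by (intro sum.cong) (auto simp: power2_eq_square)
  moreover have "w \<bullet> (M *v z) = real (card S)"
    using x(2) by (simp add: Mz w_inner)
  ultimately show ?thesis
    using pos_semidef_Cauchy_Schwarz[OF psd, of w z]
    by (simp add: Mz mult.commute inner_commute[of z] flip: z_def)
qed

lemma k_independence_number_attained:
  fixes G :: "'n::finite pair_pre_digraph"
  obtains S where "k_independent k G S" and "card S = k_independence_number k G"
proof -
  let ?C = "{card U | U. k_independent k G U}"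
  have "?C = card ` {U. k_independent k G U}" by auto
  then have "finite ?C" by simp
  \<comment> \<open>The empty set guarantees that \<open>Max\<close> ranges over a nonempty
    set.\<close>
  moreover have "k_independent k G {}" by (simp add: k_independent_def)
  then have "?C \<noteq> {}" by blast
  ultimately have "Max ?C \<in> ?C" by (rule Max_in)
  then show ?thesis
    using that by (auto simp: k_independence_number_def)
qed

theorem theorem5:
  fixes k :: nat and G :: "'n::finite pair_pre_digraph"
    and M :: "real^'n^'n" and x :: "real^'n"
  assumes "k \<ge> 1"
    and "pair_graph G" and "pverts G = UNIV"
    and "(M, x) \<in> matrix_vector_pairs k G"
  shows "(\<forall>S. k_independent k G S \<longrightarrow>
            (real (card S))\<^sup>2
              \<le> (x \<bullet> (group_inverse M *v x)) * (\<Sum>u\<in>S. M $ u $ u / (x $ u)\<^sup>2))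
       \<and> real (k_independence_number k G)
            \<le> (x \<bullet> (group_inverse M *v x)) * Max ((\<lambda>u. M $ u $ u / (x $ u)\<^sup>2) ` pverts G)
       \<and> (\<forall>t V. k_distance_coloring k G t V \<longrightarrow>
            (\<Sum>i=1..t. (real (card (V i)))\<^sup>2)
              \<le> (x \<bullet> (group_inverse M *v x)) * (\<Sum>u\<in>pverts G. M $ u $ u / (x $ u)\<^sup>2))"
proof (intro conjI allI impI)
  let ?q = "x \<bullet> (group_inverse M *v x)"
  let ?d = "\<lambda>u. M $ u $ u / (x $ u)\<^sup>2"
  have psd: "pos_semidef M" and x: "x \<in> range ((*v) M)" "\<And>i. x $ i \<noteq> 0"
    and zero: "\<And>i j. graph_dist G i j > ereal (real k) \<Longrightarrow> M $ i $ j = 0"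
    using assms(4) by (auto simp: matrix_vector_pairs_def)
  have q: "?q \<ge> 0"
    using psd x(1) by (rule group_inverse_form_nonneg)
  show bound: "(real (card S))\<^sup>2 \<le> ?q * (\<Sum>u\<in>S. ?d u)" if "k_independent k G S" for S
    using that by (intro card_squared_le_of_diagonal_on psd x zero) (auto simp: k_independent_def)
  show "real (k_independence_number k G) \<le> ?q * Max (?d ` pverts G)"
  proof -
    obtain S where S: "k_independent k G S" "card S = k_independence_number k G"
      by (rule k_independence_number_attained)
    let ?m = "Max (?d ` pverts G)"
    have le_m: "?d u \<le> ?m" for u
      using assms(3) by (intro Max_ge) auto
    \<comment> \<open>Here \<open>undefined\<close> is just some vertex; one nonnegative value makes
      the maximum nonnegative.\<close>
    have "0 \<le> ?d undefined"
      by (simp add: pos_semidef_diagonal_nonneg[OF psd])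
    also note le_m
    finally have "?m \<ge> 0" .
    have "(\<Sum>u\<in>S. ?d u) \<le> real (card S) * ?m"
      using le_m by (intro sum_bounded_above)
    then have "?q * (\<Sum>u\<in>S. ?d u) \<le> ?q * (real (card S) * ?m)"
      using q by (rule mult_left_mono)
    with bound[OF S(1)] have "real (card S) * real (card S) \<le> real (card S) * (?q * ?m)"
      by (simp add: power2_eq_square mult.left_commute)
    \<comment> \<open>Cancel one factor \<open>card S\<close>; if it is zero, the right-hand side is
      still nonnegative.\<close>
    then have "real (card S) \<le> ?q * ?m"
      using q \<open>?m \<ge> 0\<close> by (cases "card S = 0") auto
    then show ?thesis by (simp add: S(2))
  qed
  show "(\<Sum>i=1..t. (real (card (V i)))\<^sup>2) \<le> ?q * (\<Sum>u\<in>pverts G. ?d u)"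
    if V: "k_distance_coloring k G t V" for t V
  proof -
    have "(\<Sum>i=1..t. (real (card (V i)))\<^sup>2) \<le> (\<Sum>i=1..t. ?q * (\<Sum>u\<in>V i. ?d u))"
      using V by (intro sum_mono bound) (auto simp: k_distance_coloring_def)
    also have "\<dots> = ?q * (\<Sum>i=1..t. \<Sum>u\<in>V i. ?d u)"
      by (simp add: sum_distrib_left)
    \<comment> \<open>Disjointness of the classes lets the bounds add up without counting a vertex
      twice.\<close>
    also have "(\<Sum>i=1..t. \<Sum>u\<in>V i. ?d u) = (\<Sum>u\<in>(\<Union>i\<in>{1..t}. V i). ?d u)"
      using V by (intro sum.UNION_disjoint[symmetric])
        (auto simp: k_distance_coloring_def disjoint_family_on_def)
    also have "(\<Union>i\<in>{1..t}. V i) = pverts G"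
      using V by (simp add: k_distance_coloring_def)
    finally show ?thesis .
  qed
qed

end
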